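(* Let $\mathbb A=(A,+)$ be a cancellative (not necessarily commutative) semigroup, let $n$ be a positive integer, and let $X_1,\ldots,X_n\subseteq A$ be such that $X_1^\times+\cdots+X_n^\times\neq\emptyset$. Let $\kappa:=|X_1|+\cdots+|X_n|+1-n$ and assume that $\operatorname{ord}(x)\ge\kappa$ for every $x\in A\setminus\{0\}$. Then $$|X_1+\cdots+X_n|\ge\kappa.$$
   Context: A semigroup $\mathbb A=(A,+)$ is a set $A$ with an associative binary operation $+$ (written additively, but not assumed commutative; no identity is assumed). An element $z\in A$ is cancellable if, for all $x,y\in A$, $x+z=y+z$ implies $x=y$ and $z+x=z+y$ implies $x=y$; $\mathbb A$ is cancellative if every element of $A$ is cancellable. $\mathbb A^\times$ is the set of units of $\mathbb A$: if $\mathbb A$ has an identity (i.e. is a monoid), a unit is an element having a two-sided inverse; if $\mathbb A$ has no identity, $\mathbb A^\times:=\emptyset$. For $Z\subseteq A$, $Z^\times := Z\cap \mathbb A^\times$. The symbol $0$ denotes the identity of $\mathbb A$ if $\mathbb A$ has one, and otherwise an element not in $A$ adjoined as an identity. For sets, $X_1+\cdots+X_n:=\{x_1+\cdots+x_n : x_i\in X_i\}$. $|X|$ is the number of elements of $X$ if $X$ is finite and $|X|:=\infty$ otherwise. For $z\in A$, $\operatorname{ord}(z)$ is the cardinality of the subsemigroup generated by $z$ (an element of $\mathbf N\cup\{\infty\}$, where $\mathbf N$ is the set of non-negative integers). *)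

theory Defs
  imports Main "HOL-Library.Extended_Nat"
begin

definition ecard :: "'a set \<Rightarrow> enat" where
  "ecard S = (if finite S then enat (card S) else \<infinity>)"

text \<open>A semigroup need not have an identity, so being the identity is a predicate rather than
  the constant \<open>0\<close>. Without an identity, no element satisfies \<open>is_identity\<close> and
  \<open>add_units\<close> is empty.\<close>

definition is_identity :: "'a::semigroup_add \<Rightarrow> bool" where
  "is_identity e \<longleftrightarrow> (\<forall>x. e + x = x \<and> x + e = x)"

definition add_units :: "'a::semigroup_add set" where
  "add_units = {u. \<exists>e v. is_identity e \<and> u + v = e \<and> v + u = e}"

definition subsemigroup :: "'a::semigroup_add set \<Rightarrow> bool" where
  "subsemigroup S \<longleftrightarrow> (\<forall>x\<in>S. \<forall>y\<in>S. x + y \<in> S)"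

definition add_ord :: "'a::semigroup_add \<Rightarrow> enat" where
  "add_ord z = ecard (subsemigroup hull {z})"

text \<open>\<open>x 1 + \<dots> + x n\<close> in this order, as \<open>+\<close> need not be commutative. Only meaningful for
  \<open>n \<ge> 1\<close>, since there may be no empty sum.\<close>

definition ordered_sum :: "(nat \<Rightarrow> 'a::semigroup_add) \<Rightarrow> nat \<Rightarrow> 'a" where
  "ordered_sum x n = foldl (+) (x 1) (map x [2..<Suc n])"

definition sumset :: "(nat \<Rightarrow> 'a::semigroup_add set) \<Rightarrow> nat \<Rightarrow> 'a set" where
  "sumset X n = {ordered_sum x n | x. \<forall>i\<in>{1..n}. x i \<in> X i}"

text \<open>\<open>|X 1| + \<dots> + |X n| + 1 - n\<close>. Subtraction on \<^typ>\<open>enat\<close> is truncated, but the sum is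
  at least \<open>n\<close> as soon as all \<open>X i\<close> are nonempty; moreover \<open>\<infinity> - n = \<infinity>\<close>.\<close>

definition kappa :: "(nat \<Rightarrow> 'a set) \<Rightarrow> nat \<Rightarrow> enat" where
  "kappa X n = (\<Sum>i=1..n. ecard (X i)) + 1 - enat n"

end

theory Submission
  imports Defs "HOL-Library.Set_Algebras"
begin

text \<open>For two summands, translate by units so that both \<open>X\<close> and \<open>Y\<close> contain the identity \<open>e\<close>. If
  \<open>X \<inter> Y = {e}\<close>, then \<open>X + Y \<supseteq> X \<union> Y\<close> already has \<open>|X| + |Y| - 1\<close> elements. Otherwise pick
  \<open>z \<in> X \<inter> Y\<close> with \<open>z \<noteq> e\<close> and consider Kemperman's transforms
  \<open>(X \<union> (X + z), {y \<in> Y. z + y \<in> Y})\<close> and \<open>({x \<in> X. x + z \<in> X}, Y \<union> (z + Y))\<close>. By associativity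
  both have their sum inside \<open>X + Y\<close>, and by cancellation the four cardinalities add up to
  \<open>2|X| + 2|Y|\<close>. So either the second pair has larger total size, or the first one has at least the
  same total size, and then its first component is strictly larger than \<open>X\<close>: if \<open>X + z \<subseteq> X\<close>, then
  \<open>X\<close> contains every multiple of \<open>z\<close> and \<open>ord z \<le> |X| \<le> |X + Y|\<close>. The sizes are bounded by
  \<open>|X + Y|\<close>, so the process ends. The case of \<open>n\<close> summands follows by induction from the form
  \<open>|X + Y| \<ge> min(K, |X| + |Y| - 1)\<close>, where \<open>K\<close> bounds all orders from below.\<close>

section \<open>Identities, orders and translates\<close>

lemma is_identityD:
  assumes "is_identity e"
  shows "e + x = x" "x + e = x"
  using assms by (auto simp: is_identity_def)

lemma is_identity_unique: "is_identity e \<Longrightarrow> is_identity e' \<Longrightarrow> e = e'"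
  by (metis is_identityD)

lemma ecard_mono: "A \<subseteq> B \<Longrightarrow> ecard A \<le> ecard B"
  by (auto simp: ecard_def card_mono dest: finite_subset)

text \<open>The elements \<open>w\<close> with \<open>X + w\<close> inside \<open>X\<close> form a
  subsemigroup containing \<open>z\<close>, and each such \<open>w = e + w\<close> lies in
  \<open>X\<close> itself.\<close>

lemma add_ord_le_ecard:
  fixes z e :: "'a::semigroup_add"
  assumes "is_identity e" "e \<in> X" "\<And>x. x \<in> X \<Longrightarrow> x + z \<in> X"
  shows "add_ord z \<le> ecard X"
proof -
  define T where "T = {w. \<forall>x\<in>X. x + w \<in> X}"
  have "subsemigroup T"
    unfolding subsemigroup_def T_def by (auto simp flip: add.assoc)
  moreover have "{z} \<subseteq> T"
    using assms(3) by (auto simp: T_def)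
  ultimately have "subsemigroup hull {z} \<subseteq> T"
    by (intro hull_minimal)
  also have "T \<subseteq> X"
    using assms(1,2) is_identityD(1)[OF assms(1)] by (force simp: T_def)
  finally show ?thesis
    unfolding add_ord_def by (rule ecard_mono)
qed

text \<open>Translation by \<open>z\<close> maps the elements that stay in \<open>X\<close>
  bijectively onto the intersection of \<open>X\<close> with its translate; the rest is
  inclusion-exclusion.\<close>

lemma card_Un_translate_right:
  fixes z :: "'a::cancel_semigroup_add"
  assumes "finite X"
  shows "card (X \<union> (\<lambda>x. x + z) ` X) + card {x \<in> X. x + z \<in> X} = 2 * card X"
proof -
  have inj: "inj_on (\<lambda>x. x + z) S" for S
    by (auto simp: inj_on_def)
  have "(\<lambda>x. x + z) ` {x \<in> X. x + z \<in> X} = X \<inter> (\<lambda>x. x + z) ` X"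
    by auto
  hence "card {x \<in> X. x + z \<in> X} = card (X \<inter> (\<lambda>x. x + z) ` X)"
    by (metis card_image inj)
  thus ?thesis
    using card_Un_Int[of X "(\<lambda>x. x + z) ` X"] assms by (simp add: card_image inj)
qed

lemma card_Un_translate_left:
  fixes z :: "'a::cancel_semigroup_add"
  assumes "finite Y"
  shows "card (Y \<union> (+) z ` Y) + card {y \<in> Y. z + y \<in> Y} = 2 * card Y"
proof -
  have inj: "inj_on ((+) z) S" for S
    by (auto simp: inj_on_def)
  have "(+) z ` {y \<in> Y. z + y \<in> Y} = Y \<inter> (+) z ` Y"
    by auto
  hence "card {y \<in> Y. z + y \<in> Y} = card (Y \<inter> (+) z ` Y)"
    by (metis card_image inj)
  thus ?thesis
    using card_Un_Int[of Y "(+) z ` Y"] assms by (simp add: card_image inj)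
qed

section \<open>Sums of two sets\<close>

text \<open>The transforms may shrink \<open>X + Y\<close>, so a fixed upper bound \<open>N\<close>
  stands in for its size; this keeps the induction measures comparable.\<close>

lemma card_set_plus_ge_identity:
  fixes X Y :: "'a::cancel_semigroup_add set"
  assumes e: "is_identity e"
    and ord: "\<And>x::'a. \<not> is_identity x \<Longrightarrow> enat K \<le> add_ord x"
    and "finite X" "finite Y" "e \<in> X" "e \<in> Y"
    and "card (X + Y) \<le> N" and "N < K"
  shows "card X + card Y \<le> N + 1"
  using assms(3-7)
\<comment> \<open>The order is lexicographic: the total size grows, or it stays equal while the
  first set grows. Both sets have at most \<open>N\<close> elements, so the truncated differences do
  decrease.\<close>
proof (induction "(X, Y)" arbitrary: X Y
    rule: wf_induct_rule[OF wf_measures, of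
      "[\<lambda>(X, Y). 2 * N - (card X + card Y), \<lambda>(X, Y). N - card X]"])
  case (1 X Y)
  have fin: "finite (X + Y)"
    using 1 by (intro finite_set_plus)
  have Xsub: "X \<subseteq> X + Y" and Ysub: "Y \<subseteq> X + Y"
    using "1.prems"(3,4) is_identityD[OF e] by (metis set_plus_intro subsetI)+
  have leN: "card A \<le> N" if "A \<subseteq> X + Y" for A
    using card_mono[OF fin that] "1.prems"(5) by linarith
  show ?case
  proof (cases "X \<inter> Y = {e}")
    case True
    thus ?thesis
      using card_Un_Int[OF "1.prems"(1,2)] leN[of "X \<union> Y"] Xsub Ysub by simp
  next
    case False
    then obtain z where z: "z \<in> X" "z \<in> Y" "z \<noteq> e"
      using "1.prems"(3,4) by blast
    define X1 Y1 where "X1 = X \<union> (\<lambda>x. x + z) ` X" and "Y1 = {y \<in> Y. z + y \<in> Y}"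
    define X2 Y2 where "X2 = {x \<in> X. x + z \<in> X}" and "Y2 = Y \<union> (+) z ` Y"
    have fins: "finite X1" "finite Y1" "finite X2" "finite Y2"
      using "1.prems" by (auto simp: X1_def Y1_def X2_def Y2_def)
    \<comment> \<open>That \<open>e\<close> survives in \<open>Y1\<close> and \<open>X2\<close> is
      exactly \<open>z \<in> Y\<close> and \<open>z \<in> X\<close>.\<close>
    have mem: "e \<in> X1" "e \<in> Y1" "e \<in> X2" "e \<in> Y2"
      using "1.prems" z is_identityD[OF e] by (auto simp: X1_def Y1_def X2_def Y2_def)
    have sub1: "X1 + Y1 \<subseteq> X + Y"
      by (auto simp: X1_def Y1_def set_plus_def add.assoc) blast
    have sub2: "X2 + Y2 \<subseteq> X + Y"
      by (auto simp: X2_def Y2_def set_plus_def simp flip: add.assoc) blast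
    have tot: "card X1 + card X2 = 2 * card X" "card Y2 + card Y1 = 2 * card Y"
      using card_Un_translate_right card_Un_translate_left "1.prems"(1,2)
      by (auto simp: X1_def Y1_def X2_def Y2_def)
    have sub': "X1 \<subseteq> X + Y" "Y1 \<subseteq> X + Y" "X2 \<subseteq> X + Y" "Y2 \<subseteq> X + Y"
      using sub1 sub2 mem is_identityD[OF e] by (metis set_plus_intro subset_iff)+
    have le: "card X1 \<le> N" "card Y1 \<le> N" "card X2 \<le> N" "card Y2 \<le> N"
      using leN sub' by auto
    have "X1 \<noteq> X"
    proof
      assume "X1 = X"
      hence "add_ord z \<le> ecard X"
        using e "1.prems"(3) by (intro add_ord_le_ecard) (auto simp: X1_def)
      moreover have "enat K \<le> add_ord z"
        using ord z(3) e is_identity_unique by blast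
      ultimately have "enat K \<le> ecard X"
        by (rule order_trans[rotated])
      thus False
        using leN[OF Xsub] \<open>N < K\<close> "1.prems"(1) by (simp add: ecard_def)
    qed
    hence "card X < card X1"
      using fins(1) by (intro psubset_card_mono) (auto simp: X1_def)
    show ?thesis
    proof (cases "card X + card Y \<le> card X1 + card Y1")
      case True
      have "card X1 + card Y1 \<le> N + 1"
        using True \<open>card X < card X1\<close> le fins mem leN[OF sub1]
        by (intro "1.hyps") auto
      thus ?thesis using True by linarith
    next
      case False
      hence "card X + card Y < card X2 + card Y2"
        using tot by linarith
      hence "card X2 + card Y2 \<le> N + 1"
        using le fins mem leN[OF sub2] by (intro "1.hyps") auto
      thus ?thesis using \<open>card X + card Y < _\<close> by linarith
    qed
  qed
qed

lemma card_set_plus_ge: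
  fixes X Y :: "'a::cancel_semigroup_add set"
  assumes ord: "\<And>x::'a. \<not> is_identity x \<Longrightarrow> enat K \<le> add_ord x"
    and fin: "finite X" "finite Y"
    and "a \<in> X" "a \<in> add_units" "b \<in> Y" "b \<in> add_units"
  shows "min K (card X + card Y - 1) \<le> card (X + Y)"
proof (cases "K \<le> card (X + Y)")
  case False
  obtain e u where e: "is_identity e" and u: "u + a = e"
    using assms(5) by (auto simp: add_units_def)
  obtain v where v: "b + v = e"
    using assms(7) is_identity_unique[OF e] by (auto simp: add_units_def)
  define X' Y' where "X' = (+) u ` X" and "Y' = (\<lambda>y. y + v) ` Y"
  \<comment> \<open>Translating only on the outer sides makes the new sumset an injective image of
    the old one, without commutativity.\<close>
  have "X' + Y' = (\<lambda>w. u + w + v) ` (X + Y)"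
    by (force simp: X'_def Y'_def set_plus_def add.assoc)
  hence "card (X' + Y') = card (X + Y)"
    by (simp add: card_image inj_on_def)
  moreover have "card X' = card X" "card Y' = card Y"
    by (auto simp: X'_def Y'_def card_image inj_on_def)
  moreover have "card X' + card Y' \<le> card (X' + Y') + 1"
  proof (rule card_set_plus_ge_identity[OF e ord])
    show "e \<in> X'" "e \<in> Y'"
      unfolding X'_def Y'_def using assms(4,6) u v by (metis imageI)+
  qed (use fin False calculation(1) in \<open>auto simp: X'_def Y'_def\<close>)
  ultimately show ?thesis by simp
qed simp

lemma infinite_set_plus:
  fixes X Y :: "'a::cancel_semigroup_add set"
  assumes "X \<noteq> {}" "Y \<noteq> {}" "infinite X \<or> infinite Y"
  shows "infinite (X + Y)"
proof -
  obtain a b where "a \<in> X" "b \<in> Y"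
    using assms by auto
  hence "(\<lambda>x. x + b) ` X \<subseteq> X + Y" "(+) a ` Y \<subseteq> X + Y"
    by (auto simp: set_plus_def)
  moreover have "inj_on (\<lambda>x. x + b) X" "inj_on ((+) a) Y"
    by (auto simp: inj_on_def)
  ultimately show ?thesis
    using assms(3) by (meson finite_imageD finite_subset)
qed

lemma add_units_plus:
  assumes "a \<in> add_units" "b \<in> add_units"
  shows "a + b \<in> add_units"
proof -
  obtain e u where e: "is_identity e" and u: "a + u = e" "u + a = e"
    using assms(1) by (auto simp: add_units_def)
  obtain v where v: "b + v = e" "v + b = e"
    using assms(2) is_identity_unique[OF e] by (auto simp: add_units_def)
  have "(a + b) + (v + u) = a + (b + v) + u" "(v + u) + (a + b) = v + (u + a) + b"
    by (simp_all add: add.assoc)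
  hence "(a + b) + (v + u) = e" "(v + u) + (a + b) = e"
    using u v is_identityD[OF e] by simp_all
  thus ?thesis
    using e by (auto simp: add_units_def)
qed

section \<open>Sums of n sets\<close>

lemma ordered_sum_1: "ordered_sum x (Suc 0) = x (Suc 0)"
  by (simp add: ordered_sum_def)

lemma ordered_sum_Suc: "m \<ge> 1 \<Longrightarrow> ordered_sum x (Suc m) = ordered_sum x m + x (Suc m)"
  by (simp add: ordered_sum_def)

lemma ordered_sum_cong:
  assumes "m \<ge> 1" "\<And>i. i \<in> {1..m} \<Longrightarrow> x i = y i"
  shows "ordered_sum x m = ordered_sum y m"
  using assms by (induction m rule: dec_induct) (simp_all add: ordered_sum_1 ordered_sum_Suc)

lemma sumset_1: "sumset X (Suc 0) = X (Suc 0)"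
  by (force simp: sumset_def ordered_sum_1)

lemma sumset_Suc:
  assumes "m \<ge> 1"
  shows "sumset X (Suc m) = sumset X m + X (Suc m)"
proof (intro equalityI subsetI)
  fix s assume "s \<in> sumset X m + X (Suc m)"
  then obtain x b where x: "\<forall>i\<in>{1..m}. x i \<in> X i" and b: "b \<in> X (Suc m)"
    and s: "s = ordered_sum x m + b"
    by (auto simp: sumset_def set_plus_def)
  define y where "y = x(Suc m := b)"
  have "ordered_sum y m = ordered_sum x m"
    using assms by (intro ordered_sum_cong) (auto simp: y_def)
  hence "s = ordered_sum y (Suc m)"
    using assms s by (simp add: ordered_sum_Suc y_def)
  moreover have "\<forall>i\<in>{1..Suc m}. y i \<in> X i"
    using x b by (auto simp: y_def)
  ultimately show "s \<in> sumset X (Suc m)"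
    by (auto simp: sumset_def)
qed (use assms in \<open>force simp: sumset_def set_plus_def ordered_sum_Suc\<close>)

lemma sumset_unit:
  assumes "m \<ge> 1" "\<And>i. i \<in> {1..m} \<Longrightarrow> X i \<inter> add_units \<noteq> {}"
  shows "\<exists>a\<in>sumset X m. a \<in> add_units"
  using assms
proof (induction m rule: dec_induct)
  case base
  thus ?case by (auto simp: sumset_1)
next
  case (step m)
  then obtain a where "a \<in> sumset X m" "a \<in> add_units"
    by force
  moreover obtain b where "b \<in> X (Suc m)" "b \<in> add_units"
    using step.prems[of "Suc m"] by auto
  ultimately show ?case
    using step.hyps add_units_plus by (auto simp: sumset_Suc set_plus_def)
qed

lemma finite_sumset:
  assumes "m \<ge> 1" "\<And>i. i \<in> {1..m} \<Longrightarrow> finite (X i)"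
  shows "finite (sumset X m)"
  using assms
  by (induction m rule: dec_induct) (auto simp: sumset_1 sumset_Suc intro!: finite_set_plus)

lemma infinite_sumset:
  fixes X :: "nat \<Rightarrow> 'a::cancel_semigroup_add set"
  assumes "m \<ge> 1" "\<And>i. i \<in> {1..m} \<Longrightarrow> X i \<noteq> {}" "\<exists>i\<in>{1..m}. infinite (X i)"
  shows "sumset X m \<noteq> {} \<and> infinite (sumset X m)"
proof -
  \<comment> \<open>The infinite set may come only after the first \<open>m\<close>, so its
    existence becomes a premise; nonemptiness provides an element to translate by.\<close>
  have "sumset X m \<noteq> {} \<and> ((\<exists>i\<in>{1..m}. infinite (X i)) \<longrightarrow> infinite (sumset X m))"
    using assms(1,2)
  proof (induction m rule: dec_induct)
    case base
    thus ?case by (simp add: sumset_1)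
  next
    case (step m)
    hence ne: "sumset X m \<noteq> {}" "X (Suc m) \<noteq> {}"
      by auto
    moreover have "infinite (sumset X m) \<or> infinite (X (Suc m))"
      if "\<exists>i\<in>{1..Suc m}. infinite (X i)"
      using that step by (auto simp: le_Suc_eq)
    moreover have "sumset X m + X (Suc m) \<noteq> {}"
      using ne by (auto simp: set_plus_def)
    ultimately show ?case
      using step.hyps infinite_set_plus by (simp add: sumset_Suc) blast
  qed
  thus ?thesis using assms(3) by blast
qed

text \<open>Keeping \<open>K\<close> independent of \<open>m\<close> lets one hypothesis on orders
  serve all partial sums.\<close>

lemma card_sumset_ge:
  fixes X :: "nat \<Rightarrow> 'a::cancel_semigroup_add set"
  assumes ord: "\<And>x::'a. \<not> is_identity x \<Longrightarrow> enat K \<le> add_ord x"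
    and "m \<ge> 1" "\<And>i. i \<in> {1..m} \<Longrightarrow> finite (X i)"
    and "\<And>i. i \<in> {1..m} \<Longrightarrow> X i \<inter> add_units \<noteq> {}"
  shows "min K ((\<Sum>i=1..m. card (X i)) + 1 - m) \<le> card (sumset X m)"
  using assms(2-4)
proof (induction m rule: dec_induct)
  case base
  thus ?case by (simp add: sumset_1)
next
  case (step m)
  obtain a where a: "a \<in> sumset X m" "a \<in> add_units"
    using sumset_unit[of m X] step by auto
  obtain b where b: "b \<in> X (Suc m)" "b \<in> add_units"
    using step.prems(2)[of "Suc m"] by auto
  have fin: "finite (sumset X m)" "finite (X (Suc m))"
    using finite_sumset[of m X] step by auto
  \<comment> \<open>Hence adding the next set and subtracting 1 preserves either lower bound in the
    minimum, despite truncated subtraction.\<close>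
  have "card (X (Suc m)) \<ge> 1"
    using b fin(2) by (metis One_nat_def Suc_leI card_gt_0_iff empty_iff)
  moreover have "min K (card (sumset X m) + card (X (Suc m)) - 1) \<le> card (sumset X (Suc m))"
    using card_set_plus_ge[OF ord fin a b] step.hyps by (simp add: sumset_Suc)
  moreover have "min K ((\<Sum>i=1..m. card (X i)) + 1 - m) \<le> card (sumset X m)"
    using step by auto
  ultimately show ?case
    using step.hyps by simp
qed

theorem corollary10:
  fixes X :: "nat \<Rightarrow> 'a::cancel_semigroup_add set" and n :: nat
  assumes "n \<ge> 1"
    and "sumset (\<lambda>i. X i \<inter> add_units) n \<noteq> {}"
    and "\<And>x::'a. \<not> is_identity x \<Longrightarrow> add_ord x \<ge> kappa X n"
  shows "ecard (sumset X n) \<ge> kappa X n"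
proof -
  have units: "X i \<inter> add_units \<noteq> {}" if "i \<in> {1..n}" for i
    using assms(2) that by (auto simp: sumset_def)
  show ?thesis
  proof (cases "\<forall>i\<in>{1..n}. finite (X i)")
    case False
    hence "infinite (sumset X n)"
      using infinite_sumset[of n X] assms(1) units by blast
    thus ?thesis by (simp add: ecard_def)
  next
    case True
    have "(\<Sum>i=1..n. ecard (X i)) = (\<Sum>i=1..n. of_nat (card (X i)))"
      using True by (intro sum.cong) (auto simp: ecard_def of_nat_eq_enat)
    also have "\<dots> = enat (\<Sum>i=1..n. card (X i))"
      by (simp only: of_nat_sum flip: of_nat_eq_enat)
    finally have "kappa X n = enat ((\<Sum>i=1..n. card (X i)) + 1 - n)"
      by (simp add: kappa_def one_enat_def)
    moreover have "finite (sumset X n)"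
      using finite_sumset assms(1) True by blast
    \<comment> \<open>With \<open>K\<close> equal to \<open>kappa X n\<close> both arguments of the
      minimum coincide.\<close>
    ultimately show ?thesis
      using card_sumset_ge[of "(\<Sum>i=1..n. card (X i)) + 1 - n" n X] assms(1,3) True units
      by (simp add: ecard_def)
  qed
qed

end
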